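(* Let $r:\mathbf{R}^N\to\mathbf{R}^M$ be a residual function, $C(\theta)=\frac12\sum_{m} r_m(\theta)^2$, and let $(\theta_k)_{k\ge 0}$, $(\Delta_k)_{k\ge 0}$, $(\lambda_k)_{k\ge0}$ be generated by Algorithm 1 (stated in full in the context) from a starting point $\theta_0$ and parameters $\hat\Delta>0$, $\Delta_0\in(0,\hat\Delta)$, $\alpha>0$. Write $r_k=r(\theta_k)$, $J_k$ for the Jacobian of $r$ at $\theta_k$, $g_k=J_k^Tr_k$, and $\delta\theta_1$, $\delta\theta_2$, $\delta\theta_k=\delta\theta_1+\delta\theta_2$ for the steps computed at iteration $k$. Suppose that: (i) there is a constant $\beta>0$ with $|J_k^TJ_k|\le\beta$ for all $k$; (ii) $C$ is Lipschitz continuously differentiable (that is, $C$ is continuously differentiable with Lipschitz continuous gradient) in the neighborhood $S(R_0)$ for some $R_0>0$; (iii) there is a constant $\zeta>1$ such that $|\delta\theta_1|<\zeta\Delta_k$ at each iteration $k$; (iv) there is a constant $c_1\in(0,1]$ such that at each iteration $k$ $$m_k(0)-m_k(\delta\theta_k)\ \ge\ c_1\,|g_k|\,\min\!\left(\Delta_k,\ \frac{|g_k|}{|J_k^TJ_k|}\right);$$ (v) there is a constant $\kappa>0$ such that for every $k$ and every unit vector $u\in\mathbf{R}^N$, the second directional derivative of $r$ at $\theta_k$ satisfies $\left|\sum_{\mu\nu}K_{m\mu\nu}u^\mu u^\nu\right|<\kappa$, where $K_{m\mu\nu}=\frac{\partial^2 r_m}{\partial\theta_\mu\partial\theta_\nu}(\theta_k)$.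 Then $$\liminf_{k\to\infty}|g_k|=0.$$
   Context: Notation: $|\cdot|$ denotes the Euclidean norm of vectors and the induced operator norm of matrices. For the array $K$, $\sum_{\mu\nu}K_{m\mu\nu}u^\mu u^\nu$ is regarded as a vector in $\mathbf{R}^M$ indexed by $m$, and $|\cdot|$ is its norm. The residual function $r$ is assumed to have the first and second partial derivatives used below. $J_k$ is the $M\times N$ matrix with entries $\partial r_m/\partial\theta_\mu(\theta_k)$. The gradient of $C$ at $\theta_k$ is $g_k=J_k^Tr_k$. Neighborhood: $S=\{\theta: C(\theta)\le C(\theta_0)\}$ is the level set of the starting point, and $S(R_0)=\{\theta: |\theta-\theta'|<R_0 \text{ for some } \theta'\in S\}$. Model function and reduction ratio: $$m_k(\delta\theta)=\tfrac12\left|r_k+J_k\delta\theta\right|^2,\qquad \rho_k=\frac{C(\theta_k)-C(\theta_k+\delta\theta_k)}{m_k(0)-m_k(\delta\theta_k)}.$$ Steps (Levenberg-Marquardt with geodesic acceleration, scaling matrix $D^TD=I$): at iteration $k$ a multiplier $\lambda_k\ge0$ (with $J_k^TJ_k+\lambda_kI$ invertible), associated with the step bound on $\delta\theta_1$ given by $\Delta_k$ (the step bound need only be satisfied approximately, in the sense of hypothesis (iii)), is chosen, and $$\delta\theta_1=-(J_k^TJ_k+\lambda_kI)^{-1}J_k^Tr_k,\qquad \delta\theta_2=-\tfrac12(J_k^TJ_k+\lambda_kI)^{-1}J_k^Tr'',$$ where $r''\in\mathbf{R}^M$ is the directional second derivative $r''_m=\sum_{\mu\nu}\frac{\partial^2r_m}{\partial\theta_\mu\partial\theta_\nu}(\theta_k)\,\delta\theta_{1\mu}\,\delta\theta_{1\nu}$.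 Algorithm 1. Given $\hat\Delta>0$, $\Delta_0\in(0,\hat\Delta)$, $\alpha>0$ and a starting point $\theta_0$. For $k=0,1,2,\dots$: - Calculate $\delta\theta_1$ and $\delta\theta_2$ by the formulas of this context, and set $\delta\theta_k=\delta\theta_1+\delta\theta_2$. - If $|\delta\theta_2|>\alpha|\delta\theta_1|/2$: set $\Delta_{k+1}=\frac14\Delta_k$ and $\theta_{k+1}=\theta_k$. - Otherwise evaluate $\rho_k$, and: - if $\rho_k<\frac14$, set $\Delta_{k+1}=\frac14\Delta_k$; else if $\rho_k>\frac34$ and $|\delta\theta_1|=\Delta_k$, set $\Delta_{k+1}=\min(2\Delta_k,\hat\Delta)$; else set $\Delta_{k+1}=\Delta_k$; - if $\rho_k>0$, set $\theta_{k+1}=\theta_k+\delta\theta_k$; else set $\theta_{k+1}=\theta_k$. (If $g_k=0$ then $\delta\theta_k=0$ and $\theta_{k+1}=\theta_k$ in every branch.) *)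

theory Defs
  imports "HOL-Analysis.Analysis"
begin

definition partially_differentiable :: "'n::finite \<Rightarrow> (real^'n \<Rightarrow> real) \<Rightarrow> real^'n \<Rightarrow> bool" where
  "partially_differentiable \<mu> f x \<longleftrightarrow> (\<lambda>t::real. f (x + t *\<^sub>R axis \<mu> 1)) differentiable (at 0)"

definition partial_deriv :: "'n::finite \<Rightarrow> (real^'n \<Rightarrow> real) \<Rightarrow> real^'n \<Rightarrow> real" where
  "partial_deriv \<mu> f x = deriv (\<lambda>t::real. f (x + t *\<^sub>R axis \<mu> 1)) 0"

text \<open>All first and second partial derivatives of the components of r exist at x. For the second
  partial derivative first by \<nu>, then by \<mu>, the first one must exist on the line through x in
  direction \<mu>, near x. As t ranges over a full neighbourhood of 0 (including 0 itself), the first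
  clause also covers the first partial derivatives at x.\<close>

definition has_second_partials :: "(real^'n \<Rightarrow> real^'m) \<Rightarrow> real^'n::finite \<Rightarrow> bool" where
  "has_second_partials r x \<longleftrightarrow>
     (\<forall>m \<mu> \<nu>.
        (\<forall>\<^sub>F t in nhds (0::real). partially_differentiable \<nu> (\<lambda>y. r y $ m) (x + t *\<^sub>R axis \<mu> 1)) \<and>
        partially_differentiable \<mu> (partial_deriv \<nu> (\<lambda>y. r y $ m)) x)"

definition jacobian :: "(real^'n \<Rightarrow> real^'m) \<Rightarrow> real^'n::finite \<Rightarrow> real^'n^'m::finite" where
  "jacobian r x = (\<chi> m \<mu>. partial_deriv \<mu> (\<lambda>y. r y $ m) x)"

definition second_partial ::
  "(real^'n \<Rightarrow> real^'m) \<Rightarrow> real^'n::finite \<Rightarrow> 'm::finite \<Rightarrow> 'n \<Rightarrow> 'n \<Rightarrow> real" where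
  "second_partial r x m \<mu> \<nu> = partial_deriv \<mu> (partial_deriv \<nu> (\<lambda>y. r y $ m)) x"

definition second_dir_deriv ::
  "(real^'n \<Rightarrow> real^'m) \<Rightarrow> real^'n::finite \<Rightarrow> real^'n \<Rightarrow> real^'m::finite" where
  "second_dir_deriv r x u = (\<chi> m. \<Sum>\<mu>\<in>UNIV. \<Sum>\<nu>\<in>UNIV. second_partial r x m \<mu> \<nu> * u $ \<mu> * u $ \<nu>)"

text \<open>The norm of the type \<^typ>\<open>real^'n^'m\<close> is not the operator norm, hence:\<close>

definition op_norm :: "real^'n::finite^'m::finite \<Rightarrow> real" where
  "op_norm A = onorm ((*v) A)"

definition cost :: "(real^'n \<Rightarrow> real^'m::finite) \<Rightarrow> real^'n::finite \<Rightarrow> real" where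
  "cost r x = (1/2) * (\<Sum>m\<in>UNIV. (r x $ m)\<^sup>2)"

definition cost_grad :: "(real^'n \<Rightarrow> real^'m::finite) \<Rightarrow> real^'n::finite \<Rightarrow> real^'n" where
  "cost_grad r x = transpose (jacobian r x) *v r x"

definition gram :: "(real^'n \<Rightarrow> real^'m::finite) \<Rightarrow> real^'n::finite \<Rightarrow> real^'n^'n" where
  "gram r x = transpose (jacobian r x) ** jacobian r x"

definition damped_gram ::
  "(real^'n \<Rightarrow> real^'m::finite) \<Rightarrow> real^'n::finite \<Rightarrow> real \<Rightarrow> real^'n^'n" where
  "damped_gram r x lam = gram r x + lam *\<^sub>R mat 1"

definition step1 :: "(real^'n \<Rightarrow> real^'m::finite) \<Rightarrow> real^'n::finite \<Rightarrow> real \<Rightarrow> real^'n" where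
  "step1 r x lam = - (matrix_inv (damped_gram r x lam) *v (transpose (jacobian r x) *v r x))"

definition step2 :: "(real^'n \<Rightarrow> real^'m::finite) \<Rightarrow> real^'n::finite \<Rightarrow> real \<Rightarrow> real^'n" where
  "step2 r x lam =
     - (1/2) *\<^sub>R (matrix_inv (damped_gram r x lam) *v
         (transpose (jacobian r x) *v second_dir_deriv r x (step1 r x lam)))"

definition full_step :: "(real^'n \<Rightarrow> real^'m::finite) \<Rightarrow> real^'n::finite \<Rightarrow> real \<Rightarrow> real^'n" where
  "full_step r x lam = step1 r x lam + step2 r x lam"

definition model :: "(real^'n \<Rightarrow> real^'m::finite) \<Rightarrow> real^'n::finite \<Rightarrow> real^'n \<Rightarrow> real" where
  "model r x d = (1/2) * (norm (r x + jacobian r x *v d))\<^sup>2"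

text \<open>The reduction ratio. If the gradient vanishes, then so does the step, and the ratio 0/0 has
  the value 0 here; every branch of the algorithm then leaves the iterate unchanged.\<close>

definition reduction_ratio ::
  "(real^'n \<Rightarrow> real^'m::finite) \<Rightarrow> real^'n::finite \<Rightarrow> real^'n \<Rightarrow> real" where
  "reduction_ratio r x d = (cost r x - cost r (x + d)) / (model r x 0 - model r x d)"

definition next_radius ::
  "(real^'n \<Rightarrow> real^'m::finite) \<Rightarrow> real \<Rightarrow> real \<Rightarrow> real^'n::finite \<Rightarrow> real \<Rightarrow> real \<Rightarrow> real" where
  "next_radius r \<Delta>max \<alpha> x \<Delta> lam =
     (if norm (step2 r x lam) > \<alpha> * norm (step1 r x lam) / 2 then \<Delta> / 4
      else let \<rho> = reduction_ratio r x (full_step r x lam) in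
        if \<rho> < 1/4 then \<Delta> / 4
        else if \<rho> > 3/4 \<and> norm (step1 r x lam) = \<Delta> then min (2 * \<Delta>) \<Delta>max
        else \<Delta>)"

definition next_point ::
  "(real^'n \<Rightarrow> real^'m::finite) \<Rightarrow> real \<Rightarrow> real^'n::finite \<Rightarrow> real \<Rightarrow> real^'n" where
  "next_point r \<alpha> x lam =
     (if norm (step2 r x lam) > \<alpha> * norm (step1 r x lam) / 2 then x
      else if reduction_ratio r x (full_step r x lam) > 0 then x + full_step r x lam
      else x)"

definition generated_by_algorithm ::
  "(real^'n \<Rightarrow> real^'m::finite) \<Rightarrow> real \<Rightarrow> real \<Rightarrow> real \<Rightarrow> real^'n::finite \<Rightarrow>
   (nat \<Rightarrow> real^'n) \<Rightarrow> (nat \<Rightarrow> real) \<Rightarrow> (nat \<Rightarrow> real) \<Rightarrow> bool" where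
  "generated_by_algorithm r \<Delta>max \<Delta>0 \<alpha> \<theta>0 \<theta> \<Delta> lam \<longleftrightarrow>
     \<theta> 0 = \<theta>0 \<and> \<Delta> 0 = \<Delta>0 \<and>
     (\<forall>k. lam k \<ge> 0 \<and> invertible (damped_gram r (\<theta> k) (lam k)) \<and>
          \<Delta> (Suc k) = next_radius r \<Delta>max \<alpha> (\<theta> k) (\<Delta> k) (lam k) \<and>
          \<theta> (Suc k) = next_point r \<alpha> (\<theta> k) (lam k))"

definition level_set :: "(real^'n \<Rightarrow> real^'m::finite) \<Rightarrow> real^'n::finite \<Rightarrow> (real^'n) set" where
  "level_set r \<theta>0 = {x. cost r x \<le> cost r \<theta>0}"

definition level_nbhd ::
  "(real^'n \<Rightarrow> real^'m::finite) \<Rightarrow> real^'n::finite \<Rightarrow> real \<Rightarrow> (real^'n) set" where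
  "level_nbhd r \<theta>0 R = {x. \<exists>y\<in>level_set r \<theta>0. norm (x - y) < R}"

definition lipschitz_cont_diff_on :: "('a::real_inner \<Rightarrow> real) \<Rightarrow> 'a set \<Rightarrow> bool" where
  "lipschitz_cont_diff_on f U \<longleftrightarrow>
     (\<exists>G. (\<forall>x\<in>U. GDERIV f x :> G x) \<and> continuous_on U G \<and> (\<exists>L. L-lipschitz_on U G))"

end

theory Submission
  imports Defs
begin

text \<open>
  The argument is the classical one for trust region methods; what has to be added is that the
  acceleration test cannot keep rejecting steps. Suppose the gradient norm stays above some
  \<open>\<epsilon> > 0\<close> from some iteration on.

  A gradient of norm at least \<open>\<epsilon>\<close> and a step \<open>\<delta>\<theta>\<^sub>1\<close> shorter than \<open>\<zeta> \<Delta>\<close> are compatible only if the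
  multiplier is of order \<open>\<epsilon> / (\<zeta> \<Delta>)\<close>, because \<open>\<bar>g\<bar> \<le> (\<beta> + \<lambda>) \<bar>\<delta>\<theta>\<^sub>1\<bar>\<close>. The inverse of the damped Gram
  matrix is then of order \<open>\<Delta>\<close>, and since the right-hand side defining \<open>\<delta>\<theta>\<^sub>2\<close> is quadratic in
  \<open>\<delta>\<theta>\<^sub>1\<close>, the ratio \<open>\<bar>\<delta>\<theta>\<^sub>2\<bar> / \<bar>\<delta>\<theta>\<^sub>1\<bar>\<close> is of order \<open>\<Delta>\<^sup>2\<close>. Hence the acceleration test is passed
  once \<open>\<Delta>\<close> is small (\<open>acceleration_small\<close>).

  For a step \<open>d\<close> inside the region where the gradient of the cost is Lipschitz, the actual reduction
  is at least the predicted one minus \<open>L \<bar>d\<bar>\<^sup>2\<close> (\<open>cost_reduction_ge_model_reduction\<close>). The predicted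
  reduction is at least of order \<open>\<epsilon> \<Delta>\<close> for small \<open>\<Delta>\<close>, whereas \<open>\<bar>d\<bar>\<^sup>2\<close> is of order \<open>\<Delta>\<^sup>2\<close>; so the
  reduction ratio is at least one quarter and a small radius is never reduced further.

  The radius is therefore bounded away from zero. An iteration that does not reduce the radius
  lowers the cost by a fixed amount, and this can happen only finitely often because the cost is
  nonnegative. So eventually every iteration divides the radius by four, which contradicts the lower
  bound (\<open>no_persistent_shrink_or_decrease\<close>).
\<close>

section \<open>Gram matrices and damped linear systems\<close>

lemma norm_matrix_vector_le_op_norm: "norm (A *v x) \<le> op_norm A * norm x"
  unfolding op_norm_def by (rule onorm) simp

lemma op_norm_nonneg: "0 \<le> op_norm A"
  unfolding op_norm_def by (rule onorm_pos_le) simp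

lemma inner_transpose_mult:
  fixes A :: "real^'n::finite^'m::finite"
  shows "x \<bullet> (transpose A *v y) = (A *v x) \<bullet> y"
  by (metis dot_lmul_matrix transpose_matrix_vector inner_commute)

lemma inner_gram:
  fixes A :: "real^'n::finite^'m::finite"
  shows "x \<bullet> ((transpose A ** A) *v x) = (norm (A *v x))\<^sup>2"
proof -
  have "x \<bullet> ((transpose A ** A) *v x) = x \<bullet> (transpose A *v (A *v x))"
    by (simp only: matrix_vector_mul_assoc)
  also have "\<dots> = (norm (A *v x))\<^sup>2"
    by (simp only: inner_transpose_mult power2_norm_eq_inner)
  finally show ?thesis .
qed

lemma norm_mult_le_sqrt_gram:
  fixes A :: "real^'n::finite^'m::finite"
  assumes "op_norm (transpose A ** A) \<le> \<beta>"
  shows "norm (A *v x) \<le> sqrt \<beta> * norm x"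
proof -
  have \<beta>: "0 \<le> \<beta>" using assms op_norm_nonneg order_trans by blast
  have "(norm (A *v x))\<^sup>2 \<le> norm x * norm ((transpose A ** A) *v x)"
    unfolding inner_gram[symmetric] by (rule norm_cauchy_schwarz)
  also have "\<dots> \<le> norm x * (\<beta> * norm x)"
    by (intro mult_left_mono order_trans[OF norm_matrix_vector_le_op_norm] mult_right_mono assms) auto
  also have "\<dots> = (sqrt \<beta> * norm x)\<^sup>2"
    using \<beta> by (simp add: power_mult_distrib power2_eq_square)
  finally show ?thesis
    using \<beta> by (auto intro: power2_le_imp_le)
qed

text \<open>With \<open>z = A\<^sup>T y\<close>, \<open>\<bar>z\<bar>\<^sup>2 = A z \<bullet> y\<close> reduces the bound for the transpose to the one for \<open>A\<close>.\<close>

lemma norm_transpose_mult_le_sqrt_gram: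
  fixes A :: "real^'n::finite^'m::finite"
  assumes "op_norm (transpose A ** A) \<le> \<beta>"
  shows "norm (transpose A *v y) \<le> sqrt \<beta> * norm y"
proof (cases "transpose A *v y = 0")
  case True
  have "0 \<le> \<beta>" using assms op_norm_nonneg order_trans by blast
  then show ?thesis using True by simp
next
  case False
  let ?z = "transpose A *v y"
  have "norm ?z * norm ?z = (A *v ?z) \<bullet> y"
    by (metis inner_transpose_mult power2_eq_square power2_norm_eq_inner)
  also have "\<dots> \<le> norm (A *v ?z) * norm y" by (rule norm_cauchy_schwarz)
  also have "\<dots> \<le> (sqrt \<beta> * norm ?z) * norm y"
    by (rule mult_right_mono[OF norm_mult_le_sqrt_gram[OF assms]]) simp
  finally have "norm ?z * norm ?z \<le> (sqrt \<beta> * norm y) * norm ?z" by (simp add: mult_ac)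
  moreover have "0 < norm ?z" using False by simp
  ultimately show ?thesis by (rule mult_right_le_imp_le)
qed

lemma damped_gram_mult:
  "damped_gram r x lam *v p = gram r x *v p + lam *\<^sub>R p"
  unfolding damped_gram_def
  by (simp add: matrix_vector_mult_add_rdistrib scaleR_matrix_vector_assoc[symmetric])

lemma damped_solution:
  assumes "invertible (damped_gram r x lam)"
  shows "damped_gram r x lam *v (matrix_inv (damped_gram r x lam) *v b) = b"
proof -
  have "damped_gram r x lam ** matrix_inv (damped_gram r x lam) = mat 1"
    using assms unfolding invertible_def matrix_inv_def by (rule someI2_ex) simp
  then show ?thesis by (simp add: matrix_vector_mul_assoc)
qed

lemma norm_damped_gram_le:
  assumes "op_norm (gram r x) \<le> \<beta>" and "0 \<le> lam"
  shows "norm (damped_gram r x lam *v p) \<le> (\<beta> + lam) * norm p"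
proof -
  have "norm (damped_gram r x lam *v p) \<le> norm (gram r x *v p) + lam * norm p"
    using assms(2) norm_triangle_ineq[of "gram r x *v p" "lam *\<^sub>R p"] by (simp add: damped_gram_mult)
  also have "norm (gram r x *v p) \<le> \<beta> * norm p"
    using norm_matrix_vector_le_op_norm[of "gram r x" p] mult_right_mono[OF assms(1) norm_ge_zero[of p]]
    by linarith
  finally show ?thesis by (simp add: algebra_simps)
qed

text \<open>The Gram matrix is positive semidefinite, so testing the damped system against its own
  solution leaves only the damping term.\<close>

lemma damping_mult_norm_le: "lam * norm p \<le> norm (damped_gram r x lam *v p)"
proof (cases "p = 0")
  case False
  have "0 \<le> p \<bullet> (gram r x *v p)"
    unfolding gram_def inner_gram by simp
  then have "lam * norm p * norm p \<le> p \<bullet> (damped_gram r x lam *v p)"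
    by (simp add: damped_gram_mult inner_add_right power2_norm_eq_inner[symmetric] power2_eq_square)
  also have "\<dots> \<le> norm (damped_gram r x lam *v p) * norm p"
    using norm_cauchy_schwarz[of p "damped_gram r x lam *v p"] by (simp add: mult.commute)
  finally show ?thesis using False by simp
qed simp

section \<open>The acceleration test is passed for small radii\<close>

lemma second_dir_deriv_scaleR:
  "second_dir_deriv r x (c *\<^sub>R u) = c\<^sup>2 *\<^sub>R second_dir_deriv r x u"
  unfolding second_dir_deriv_def vec_eq_iff
  by (simp add: sum_distrib_left power2_eq_square mult_ac)

lemma norm_second_dir_deriv_le:
  assumes "\<And>u. norm u = 1 \<Longrightarrow> norm (second_dir_deriv r x u) < \<kappa>"
  shows "norm (second_dir_deriv r x v) \<le> \<kappa> * (norm v)\<^sup>2"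
proof (cases "v = 0")
  case True
  then show ?thesis using second_dir_deriv_scaleR[of r x 0 0] by simp
next
  case False
  define u where "u = v /\<^sub>R norm v"
  have u: "norm u = 1" "v = norm v *\<^sub>R u" unfolding u_def using False by auto
  have "norm (second_dir_deriv r x v) = (norm v)\<^sup>2 * norm (second_dir_deriv r x u)"
    by (metis second_dir_deriv_scaleR u(2) norm_scaleR abs_of_nonneg zero_le_power2)
  also have "\<dots> \<le> (norm v)\<^sup>2 * \<kappa>"
    by (rule mult_left_mono[OF less_imp_le[OF assms[OF u(1)]]]) simp
  finally show ?thesis by (simp add: mult.commute)
qed

lemma damping_mult_norm_step2_le:
  assumes "op_norm (gram r x) \<le> \<beta>"
    and "invertible (damped_gram r x lam)"
    and "\<And>u. norm u = 1 \<Longrightarrow> norm (second_dir_deriv r x u) < \<kappa>"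
  shows "lam * norm (step2 r x lam) \<le> sqrt \<beta> * \<kappa> * (norm (step1 r x lam))\<^sup>2 / 2"
proof -
  define b where "b = transpose (jacobian r x) *v second_dir_deriv r x (step1 r x lam)"
  define p where "p = matrix_inv (damped_gram r x lam) *v b"
  have \<beta>: "0 \<le> \<beta>" using assms(1) op_norm_nonneg order_trans by blast
  have "norm b \<le> sqrt \<beta> * norm (second_dir_deriv r x (step1 r x lam))"
    unfolding b_def by (rule norm_transpose_mult_le_sqrt_gram) (use assms(1) in \<open>simp add: gram_def\<close>)
  also have "\<dots> \<le> sqrt \<beta> * (\<kappa> * (norm (step1 r x lam))\<^sup>2)"
    by (intro mult_left_mono norm_second_dir_deriv_le assms(3)) (use \<beta> in auto)
  finally have "norm b \<le> sqrt \<beta> * \<kappa> * (norm (step1 r x lam))\<^sup>2" by (simp add: mult_ac)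
  moreover have "lam * norm p \<le> norm b"
    using damping_mult_norm_le[of lam p r x] damped_solution[OF assms(2), of b] by (simp add: p_def)
  moreover have "norm (step2 r x lam) = norm p / 2"
    by (simp add: step2_def p_def b_def del: transpose_matrix_vector)
  ultimately have "lam * norm (step2 r x lam) = lam * norm p / 2"
    "lam * norm p \<le> sqrt \<beta> * \<kappa> * (norm (step1 r x lam))\<^sup>2"
    by auto
  then show ?thesis by argo
qed

text \<open>The first smallness condition on the radius makes the multiplier at least
  \<open>\<epsilon> / (2 \<zeta> \<Delta>)\<close>; the second one is what this lower bound requires for the bound on the second
  step to fall below the threshold of the test.\<close>

lemma acceleration_small:
  assumes gram: "op_norm (gram r x) \<le> \<beta>"
    and inv: "invertible (damped_gram r x lam)" and lam: "0 \<le> lam"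
    and \<kappa>: "0 \<le> \<kappa>" "\<And>u. norm u = 1 \<Longrightarrow> norm (second_dir_deriv r x u) < \<kappa>"
    and \<epsilon>: "0 < \<epsilon>" "\<epsilon> \<le> norm (cost_grad r x)"
    and s1: "norm (step1 r x lam) \<le> \<zeta> * \<Delta>"
    and small: "2 * \<beta> * (\<zeta> * \<Delta>) \<le> \<epsilon>" "2 * sqrt \<beta> * \<kappa> * (\<zeta> * \<Delta>)\<^sup>2 \<le> \<alpha> * \<epsilon>" and \<alpha>: "0 \<le> \<alpha>"
  shows "norm (step2 r x lam) \<le> \<alpha> * norm (step1 r x lam) / 2"
proof -
  let ?s = "norm (step1 r x lam)" and ?b = "\<zeta> * \<Delta>"
  have \<beta>: "0 \<le> \<beta>" using gram op_norm_nonneg order_trans by blast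
  have "damped_gram r x lam *v step1 r x lam = - cost_grad r x"
    unfolding step1_def vec.neg cost_grad_def damped_solution[OF inv] ..
  then have "\<epsilon> \<le> (\<beta> + lam) * ?s"
    using norm_damped_gram_le[OF gram lam, of "step1 r x lam"] \<epsilon>(2) by simp
  also have "\<dots> \<le> (\<beta> + lam) * ?b"
    using s1 \<beta> lam by (intro mult_left_mono) auto
  finally have "\<epsilon> \<le> \<beta> * ?b + lam * ?b" by (simp add: algebra_simps)
  then have lam_large: "\<epsilon> / 2 \<le> lam * ?b" using small(1) by simp
  have b_nonneg: "0 \<le> ?b" using s1 norm_ge_zero order_trans by blast
  have "0 < lam * ?b" using lam_large \<epsilon>(1) by linarith
  then have pos: "0 < ?b" "0 < lam" using b_nonneg lam by (auto simp: zero_less_mult_iff)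
  have "sqrt \<beta> * \<kappa> * ?b * ?b \<le> \<alpha> * (\<epsilon> / 2)" using small(2) by (simp add: power2_eq_square mult_ac)
  also have "\<dots> \<le> \<alpha> * (lam * ?b)" using lam_large \<alpha> by (rule mult_left_mono)
  finally have "(sqrt \<beta> * \<kappa> * ?b) * ?b \<le> (lam * \<alpha>) * ?b" by (simp add: mult_ac)
  then have key: "sqrt \<beta> * \<kappa> * ?b \<le> lam * \<alpha>" using pos(1) by (rule mult_right_le_imp_le)
  have "sqrt \<beta> * \<kappa> * ?s \<le> sqrt \<beta> * \<kappa> * ?b"
    using s1 \<beta> \<kappa>(1) by (intro mult_left_mono) auto
  then have "sqrt \<beta> * \<kappa> * ?s * ?s \<le> lam * \<alpha> * ?s"
    using key by (intro mult_right_mono) auto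
  then have "lam * norm (step2 r x lam) \<le> lam * (\<alpha> * ?s / 2)"
    using damping_mult_norm_step2_le[OF gram inv \<kappa>(2)] by (simp add: power2_eq_square mult_ac)
  then show ?thesis using pos(2) by (rule mult_left_le_imp_le)
qed

section \<open>Actual and predicted reduction\<close>

lemma partial_deriv_of_GDERIV:
  fixes f :: "real^'n::finite \<Rightarrow> real"
  assumes "GDERIV f x :> G"
  shows "((\<lambda>t. f (x + t *\<^sub>R axis \<mu> 1)) has_real_derivative G $ \<mu>) (at 0)"
proof -
  have 1: "((\<lambda>t::real. x + t *\<^sub>R axis \<mu> 1) has_derivative (\<lambda>t. t *\<^sub>R axis \<mu> 1)) (at 0)"
    by (auto intro!: derivative_eq_intros)
  have "(f has_derivative (\<lambda>h. h \<bullet> G)) (at (x + 0 *\<^sub>R axis \<mu> 1))"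
    using assms by (simp add: gderiv_def)
  from has_derivative_compose[OF 1 this]
  show ?thesis
    by (simp add: has_field_derivative_def inner_axis inner_commute[of _ G] mult_commute_abs)
qed

text \<open>Partial derivatives at \<open>x\<close> do not make the residual differentiable there, so the chain rule
  is applied only on the coordinate lines through \<open>x\<close>; these determine the gradient of the cost.\<close>

lemma gradient_of_cost_eq:
  fixes r :: "real^'n::finite \<Rightarrow> real^'m::finite"
  assumes G: "GDERIV (cost r) x :> G" and r: "has_second_partials r x"
  shows "G = cost_grad r x"
proof (rule vec_eq_iff[THEN iffD2], rule allI)
  fix \<mu> :: 'n
  let ?l = "\<lambda>t::real. x + t *\<^sub>R axis \<mu> 1"
  have d: "((\<lambda>t. r (?l t) $ m) has_real_derivative jacobian r x $ m $ \<mu>) (at 0)" for m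
  proof -
    have "\<forall>\<^sub>F t in nhds (0::real). partially_differentiable \<mu> (\<lambda>y. r y $ m) (?l t)"
      using r by (auto simp: has_second_partials_def)
    from eventually_nhds_x_imp_x[OF this]
    have "(\<lambda>t. r (?l t) $ m) differentiable (at 0)" by (simp add: partially_differentiable_def)
    then have "(\<lambda>t. r (?l t) $ m) field_differentiable (at 0)"
      by (auto simp: real_differentiable_def field_differentiable_def)
    then show ?thesis
      unfolding jacobian_def partial_deriv_def by (simp add: DERIV_deriv_iff_field_differentiable)
  qed
  have "((\<lambda>t. cost r (?l t)) has_real_derivative
      (1/2) * (\<Sum>m\<in>UNIV. 2 * (r (?l 0) $ m * jacobian r x $ m $ \<mu>))) (at 0)"
    unfolding cost_def
    by (intro DERIV_cmult DERIV_sum) (auto intro!: derivative_eq_intros d)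
  moreover have "(1/2) * (\<Sum>m\<in>UNIV. 2 * (r (?l 0) $ m * jacobian r x $ m $ \<mu>)) = cost_grad r x $ \<mu>"
    by (simp add: cost_grad_def matrix_vector_mult_def vector_matrix_mult_def transpose_def
        sum_distrib_left[symmetric] mult.commute)
  ultimately show "G $ \<mu> = cost_grad r x $ \<mu>"
    using partial_deriv_of_GDERIV[OF G] DERIV_unique by metis
qed

lemma descent_estimate:
  fixes f :: "'a::real_inner \<Rightarrow> real"
  assumes G: "\<And>y. y \<in> U \<Longrightarrow> GDERIV f y :> G y" and L: "L-lipschitz_on U G"
    and seg: "\<And>t. 0 \<le> t \<Longrightarrow> t \<le> 1 \<Longrightarrow> x + t *\<^sub>R d \<in> U"
  shows "f (x + d) \<le> f x + d \<bullet> G x + L * (norm d)\<^sup>2"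
proof -
  have L0: "0 \<le> L" using L by (rule lipschitz_on_nonneg)
  have "((\<lambda>t. f (x + t *\<^sub>R d)) has_derivative (\<lambda>h. (h *\<^sub>R d) \<bullet> G (x + t *\<^sub>R d))) (at t within {0..1})"
    if "0 \<le> t" "t \<le> 1" for t :: real
  proof -
    have 1: "((\<lambda>t::real. x + t *\<^sub>R d) has_derivative (\<lambda>h. h *\<^sub>R d)) (at t within {0..1})"
      by (auto intro!: derivative_eq_intros)
    have "(f has_derivative (\<lambda>h. h \<bullet> G (x + t *\<^sub>R d))) (at (x + t *\<^sub>R d))"
      using G[OF seg[OF that]] by (simp add: gderiv_def)
    from has_derivative_compose[OF 1 this] show ?thesis .
  qed
  from mvt_very_simple[OF _ this] obtain t :: real
    where t: "0 \<le> t" "t \<le> 1" and eq: "f (x + d) - f x = d \<bullet> G (x + t *\<^sub>R d)"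
    by force
  have "d \<bullet> (G (x + t *\<^sub>R d) - G x) \<le> norm d * norm (G (x + t *\<^sub>R d) - G x)"
    by (rule norm_cauchy_schwarz)
  also have "\<dots> \<le> norm d * (L * (t * norm d))"
    using lipschitz_onD[OF L seg[OF t] seg[of 0]] t(1)
    by (intro mult_left_mono) (auto simp: dist_norm)
  also have "\<dots> \<le> norm d * (L * (1 * norm d))"
    using t(2) L0 by (intro mult_left_mono mult_right_mono) auto
  finally show ?thesis using eq by (simp add: inner_diff_right power2_eq_square mult_ac)
qed

lemma cost_eq_norm: "cost r x = (1/2) * (norm (r x))\<^sup>2"
  by (simp add: cost_def norm_vec_def L2_set_def sum_nonneg)

lemma model_eq:
  "model r x d = cost r x + d \<bullet> cost_grad r x + (1/2) * (norm (jacobian r x *v d))\<^sup>2"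
proof -
  have "d \<bullet> cost_grad r x = (jacobian r x *v d) \<bullet> r x"
    unfolding cost_grad_def by (rule inner_transpose_mult)
  then show ?thesis
    by (simp add: model_def cost_eq_norm power2_norm_eq_inner inner_add inner_commute algebra_simps)
qed

lemma in_level_nbhd:
  assumes "cost r x \<le> cost r \<theta>0" and "norm d < R"
  shows "x + d \<in> level_nbhd r \<theta>0 R"
  using assms unfolding level_nbhd_def level_set_def by force

text \<open>The quadratic term of the model only lowers the predicted reduction, so the Lipschitz
  constant of the gradient alone controls the discrepancy.\<close>

lemma cost_reduction_ge_model_reduction:
  assumes G: "\<And>y. y \<in> level_nbhd r \<theta>0 R \<Longrightarrow> GDERIV (cost r) y :> G y"
    and L: "L-lipschitz_on (level_nbhd r \<theta>0 R) G"
    and x: "cost r x \<le> cost r \<theta>0" and r: "has_second_partials r x" and d: "norm d < R"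
  shows "model r x 0 - model r x d - L * (norm d)\<^sup>2 \<le> cost r x - cost r (x + d)"
proof -
  have seg: "x + t *\<^sub>R d \<in> level_nbhd r \<theta>0 R" if "0 \<le> t" "t \<le> 1" for t
  proof (rule in_level_nbhd[OF x])
    have "norm (t *\<^sub>R d) \<le> 1 * norm d" using that by (simp add: mult_left_le_one_le)
    then show "norm (t *\<^sub>R d) < R" using d by simp
  qed
  have "G x = cost_grad r x"
    using G[of x] seg[of 0] by (intro gradient_of_cost_eq r) auto
  then have "cost r (x + d) \<le> cost r x + d \<bullet> cost_grad r x + L * (norm d)\<^sup>2"
    using descent_estimate[OF G L seg] by simp
  moreover have "model r x 0 = cost r x" by (simp add: model_eq)
  moreover have "cost r x + d \<bullet> cost_grad r x \<le> model r x d" by (simp add: model_eq)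
  ultimately show ?thesis by linarith
qed

text \<open>This keeps the quotient by the norm of the Gram matrix in the decrease condition from being a
  division by zero.\<close>

lemma op_norm_gram_pos:
  assumes "cost_grad r x \<noteq> 0"
  shows "0 < op_norm (gram r x)"
proof (rule ccontr)
  assume "\<not> ?thesis"
  then have "op_norm (gram r x) \<le> 0" by simp
  then have "norm (cost_grad r x) \<le> sqrt 0 * norm (r x)"
    unfolding cost_grad_def gram_def by (rule norm_transpose_mult_le_sqrt_gram)
  then show False using assms by simp
qed

lemma cauchy_decrease_ge:
  assumes "op_norm (gram r x) \<le> \<beta>" and "0 < \<epsilon>" "\<epsilon> \<le> norm (cost_grad r x)" and "0 \<le> c" "0 \<le> \<Delta>"
  shows "c * \<epsilon> * min \<Delta> (\<epsilon> / \<beta>)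
    \<le> c * norm (cost_grad r x) * min \<Delta> (norm (cost_grad r x) / op_norm (gram r x))"
proof -
  have "0 < op_norm (gram r x)" using assms by (intro op_norm_gram_pos) auto
  then have "\<epsilon> / \<beta> \<le> norm (cost_grad r x) / op_norm (gram r x)" "0 \<le> \<epsilon> / \<beta>"
    using assms by (auto intro: frac_le)
  then show ?thesis
    using assms by (intro mult_mono min.mono) auto
qed

text \<open>The assumption \<open>0 < q\<close> excludes a vanishing predicted reduction, for which the quotient takes
  the default value zero and says nothing about the cost.\<close>

lemma reduction_of_ratio_ge:
  assumes "0 \<le> model r x 0 - model r x d" and "0 < q" and q: "q \<le> reduction_ratio r x d"
  shows "q * (model r x 0 - model r x d) \<le> cost r x - cost r (x + d)"
proof -
  have "0 < model r x 0 - model r x d"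
    using assms unfolding reduction_ratio_def by (cases "model r x 0 - model r x d = 0") auto
  then show ?thesis using q unfolding reduction_ratio_def by (simp add: pos_le_divide_eq)
qed

section \<open>Behaviour of the iteration\<close>

lemma next_radius_bounds:
  assumes "0 < \<Delta>" "\<Delta> \<le> \<Delta>max"
  shows "\<Delta> / 4 \<le> next_radius r \<Delta>max \<alpha> x \<Delta> lam" "next_radius r \<Delta>max \<alpha> x \<Delta> lam \<le> \<Delta>max"
proof -
  have "\<Delta> / 4 \<le> min (2 * \<Delta>) \<Delta>max" using assms by simp
  then show "\<Delta> / 4 \<le> next_radius r \<Delta>max \<alpha> x \<Delta> lam"
    using assms(1) unfolding next_radius_def Let_def by (simp only: split: if_split) simp
  show "next_radius r \<Delta>max \<alpha> x \<Delta> lam \<le> \<Delta>max" using assms by (simp add: next_radius_def Let_def)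
qed

lemma cost_next_point_le:
  assumes "0 \<le> model r x 0 - model r x (full_step r x lam)"
  shows "cost r (next_point r \<alpha> x lam) \<le> cost r x"
  using assms
  by (auto simp: next_point_def reduction_ratio_def zero_less_divide_iff)

lemma radius_quartered_or_cost_decreased:
  assumes "0 \<le> model r x 0 - model r x (full_step r x lam)"
    and "p \<le> model r x 0 - model r x (full_step r x lam)"
  shows "next_radius r \<Delta>max \<alpha> x \<Delta> lam = \<Delta> / 4
    \<or> cost r (next_point r \<alpha> x lam) \<le> cost r x - p / 4"
proof (cases "norm (step2 r x lam) > \<alpha> * norm (step1 r x lam) / 2
    \<or> reduction_ratio r x (full_step r x lam) < 1/4")
  case True
  then show ?thesis by (auto simp: next_radius_def Let_def)
next
  case False
  then show ?thesis
    using reduction_of_ratio_ge[OF assms(1), of "1/4"] assms(2)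
    by (auto simp: next_point_def)
qed

lemma radius_not_reduced:
  assumes "norm (step2 r x lam) \<le> \<alpha> * norm (step1 r x lam) / 2"
    and "0 < model r x 0 - model r x (full_step r x lam)"
    and "L * (norm (full_step r x lam))\<^sup>2 \<le> 3/4 * (model r x 0 - model r x (full_step r x lam))"
    and "model r x 0 - model r x (full_step r x lam) - L * (norm (full_step r x lam))\<^sup>2
      \<le> cost r x - cost r (x + full_step r x lam)"
    and "0 < \<Delta>" "\<Delta> \<le> \<Delta>max"
  shows "\<Delta> \<le> next_radius r \<Delta>max \<alpha> x \<Delta> lam"
proof -
  have "1/4 \<le> reduction_ratio r x (full_step r x lam)"
    using assms(2-4) unfolding reduction_ratio_def by (simp add: pos_le_divide_eq)
  then show ?thesis using assms(1,5,6) by (auto simp: next_radius_def Let_def)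
qed

text \<open>A nonincreasing sequence bounded below can drop by \<open>\<eta>\<close> only finitely often; from then on the
  radius would decay geometrically, below \<open>\<delta>\<close>.\<close>

lemma no_persistent_shrink_or_decrease:
  fixes C D :: "nat \<Rightarrow> real"
  assumes C: "\<And>k. 0 \<le> C k" "\<And>k. C (Suc k) \<le> C k"
    and D: "0 < \<delta>" "\<And>k. K \<le> k \<Longrightarrow> \<delta> \<le> D k"
    and \<eta>: "0 < \<eta>" "\<And>k. K \<le> k \<Longrightarrow> D (Suc k) = D k / 4 \<or> C (Suc k) \<le> C k - \<eta>"
  shows False
proof -
  have "decseq C" using C(2) by (rule decseq_SucI)
  then obtain l where l: "C \<longlonglongrightarrow> l" using decseq_convergent[of C 0] C(1) by blast
  then have "(\<lambda>k. C k - C (Suc k)) \<longlonglongrightarrow> l - l" by (intro tendsto_diff LIMSEQ_Suc)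
  then have "\<forall>\<^sub>F k in sequentially. C k - C (Suc k) < \<eta>"
    using \<eta>(1) by (auto dest: order_tendstoD(2))
  then obtain K1 where K1: "\<And>k. K1 \<le> k \<Longrightarrow> C k - C (Suc k) < \<eta>"
    by (auto simp: eventually_sequentially)
  define M where "M = max K K1"
  have shrink: "D (Suc k) = D k / 4" if "M \<le> k" for k
    using \<eta>(2)[of k] K1[of k] that by (auto simp: M_def)
  have pow: "D (M + n) = D M * (1/4) ^ n" for n
    by (induction n) (auto simp: shrink)
  have "(\<lambda>n. D M * (1/4) ^ n) \<longlonglongrightarrow> D M * 0"
    by (intro tendsto_mult tendsto_const LIMSEQ_power_zero) simp
  then have "\<forall>\<^sub>F n in sequentially. D (M + n) < \<delta>"
    unfolding pow using D(1) by (auto dest: order_tendstoD(2))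
  then obtain n where "D (M + n) < \<delta>" by (auto simp: eventually_sequentially)
  moreover have "K \<le> M + n" by (simp add: M_def)
  ultimately show False using D(2)[of "M + n"] by linarith
qed

text \<open>One reduction can carry the radius from just above the threshold \<open>\<delta>\<close> to just above
  \<open>\<delta> / 4\<close>; below the threshold it cannot shrink any further.\<close>

lemma radius_bounded_below:
  fixes D :: "nat \<Rightarrow> real"
  assumes "\<And>k. K \<le> k \<Longrightarrow> D k / 4 \<le> D (Suc k)"
    and "\<And>k. K \<le> k \<Longrightarrow> D k \<le> \<delta> \<Longrightarrow> D k \<le> D (Suc k)"
    and "K \<le> k"
  shows "min (D K) (\<delta> / 4) \<le> D k"
  using assms(3)
proof (induction k rule: dec_induct)
  case (step n)
  then show ?case using assms(1,2)[of n] by (cases "D n \<le> \<delta>") auto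
qed auto

lemma liminf_eq_0_if_not_eventually_ge:
  fixes f :: "nat \<Rightarrow> real"
  assumes "\<And>k. 0 \<le> f k" and "\<And>\<epsilon> K. 0 < \<epsilon> \<Longrightarrow> (\<And>k. K \<le> k \<Longrightarrow> \<epsilon> \<le> f k) \<Longrightarrow> False"
  shows "liminf (\<lambda>k. ereal (f k)) = 0"
proof (rule antisym)
  show "0 \<le> liminf (\<lambda>k. ereal (f k))"
    by (rule Liminf_bounded) (simp add: assms(1))
  show "liminf (\<lambda>k. ereal (f k)) \<le> 0"
  proof (rule ccontr)
    assume "\<not> ?thesis"
    then have "0 < liminf (\<lambda>k. ereal (f k))" by simp
    then obtain e where e: "0 < e" "e < liminf (\<lambda>k. ereal (f k))" using dense by blast
    then obtain \<epsilon> where \<epsilon>: "e = ereal \<epsilon>" by (cases e) auto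
    have "\<forall>\<^sub>F k in sequentially. e < ereal (f k)" using e(2) by (rule less_LiminfD)
    then obtain K where "\<And>k. K \<le> k \<Longrightarrow> \<epsilon> \<le> f k"
      unfolding \<epsilon> by (auto simp: eventually_sequentially intro: less_imp_le)
    then show False using assms(2)[of \<epsilon> K] e(1) \<epsilon> by simp
  qed
qed


theorem theorem1:
  fixes r :: "real^'n::finite \<Rightarrow> real^'m::finite"
    and \<theta> :: "nat \<Rightarrow> real^'n" and \<theta>0 :: "real^'n"
    and \<Delta> lam :: "nat \<Rightarrow> real" and \<Delta>max \<Delta>0 \<alpha> :: real
  assumes "\<Delta>max > 0" and "0 < \<Delta>0" and "\<Delta>0 < \<Delta>max" and "\<alpha> > 0"
    and "generated_by_algorithm r \<Delta>max \<Delta>0 \<alpha> \<theta>0 \<theta> \<Delta> lam"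
    and "\<And>k. has_second_partials r (\<theta> k)"
    and "\<exists>\<beta>>0. \<forall>k. op_norm (gram r (\<theta> k)) \<le> \<beta>"
    and "\<exists>R0>0. lipschitz_cont_diff_on (cost r) (level_nbhd r \<theta>0 R0)"
    and "\<exists>\<zeta>>1. \<forall>k. norm (step1 r (\<theta> k) (lam k)) < \<zeta> * \<Delta> k"
    and "\<exists>c1. 0 < c1 \<and> c1 \<le> 1 \<and> (\<forall>k.
           model r (\<theta> k) 0 - model r (\<theta> k) (full_step r (\<theta> k) (lam k))
             \<ge> c1 * norm (cost_grad r (\<theta> k)) *
                min (\<Delta> k) (norm (cost_grad r (\<theta> k)) / op_norm (gram r (\<theta> k))))"
    and "\<exists>\<kappa>>0. \<forall>k u. norm u = 1 \<longrightarrow> norm (second_dir_deriv r (\<theta> k) u) < \<kappa>"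
  shows "liminf (\<lambda>k. ereal (norm (cost_grad r (\<theta> k)))) = 0"
proof -
  let ?g = "\<lambda>k. cost_grad r (\<theta> k)" and ?d = "\<lambda>k. full_step r (\<theta> k) (lam k)"
  let ?s1 = "\<lambda>k. norm (step1 r (\<theta> k) (lam k))" and ?s2 = "\<lambda>k. norm (step2 r (\<theta> k) (lam k))"
  let ?pred = "\<lambda>k. model r (\<theta> k) 0 - model r (\<theta> k) (?d k)"
  have init: "\<theta> 0 = \<theta>0" "\<Delta> 0 = \<Delta>0"
    and lam: "\<And>k. 0 \<le> lam k" and inv: "\<And>k. invertible (damped_gram r (\<theta> k) (lam k))"
    and \<Delta>_Suc: "\<And>k. \<Delta> (Suc k) = next_radius r \<Delta>max \<alpha> (\<theta> k) (\<Delta> k) (lam k)"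
    and \<theta>_Suc: "\<And>k. \<theta> (Suc k) = next_point r \<alpha> (\<theta> k) (lam k)"
    using assms(5) by (auto simp: generated_by_algorithm_def)
  obtain \<beta> where \<beta>: "0 < \<beta>" "\<And>k. op_norm (gram r (\<theta> k)) \<le> \<beta>" using assms(7) by auto
  obtain R0 G L where R0: "0 < R0" and L: "L-lipschitz_on (level_nbhd r \<theta>0 R0) G"
    and G: "\<And>y. y \<in> level_nbhd r \<theta>0 R0 \<Longrightarrow> GDERIV (cost r) y :> G y"
    using assms(8) by (auto simp: lipschitz_cont_diff_on_def)
  have L0: "0 \<le> L" using L by (rule lipschitz_on_nonneg)
  obtain \<zeta> where \<zeta>: "1 < \<zeta>" "\<And>k. ?s1 k < \<zeta> * \<Delta> k" using assms(9) by auto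
  obtain c1 where c1: "0 < c1" and pred: "\<And>k. c1 * norm (?g k) *
      min (\<Delta> k) (norm (?g k) / op_norm (gram r (\<theta> k))) \<le> ?pred k"
    using assms(10) by blast
  obtain \<kappa> where \<kappa>: "0 < \<kappa>" "\<And>k u. norm u = 1 \<Longrightarrow> norm (second_dir_deriv r (\<theta> k) u) < \<kappa>"
    using assms(11) by blast

  have \<Delta>: "0 < \<Delta> k \<and> \<Delta> k \<le> \<Delta>max" for k
  proof (induction k)
    case (Suc k)
    then show ?case
      using next_radius_bounds[of "\<Delta> k" \<Delta>max r \<alpha> "\<theta> k" "lam k"] by (simp add: \<Delta>_Suc)
  qed (use assms(2,3) init in simp)
  have quarter: "\<Delta> k / 4 \<le> \<Delta> (Suc k)" for k
    unfolding \<Delta>_Suc using \<Delta>[of k] by (intro next_radius_bounds) auto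
  have pred0: "0 \<le> ?pred k" for k
    using \<Delta>[of k] c1 op_norm_nonneg[of "gram r (\<theta> k)"]
    by (intro order_trans[OF _ pred[of k]]) (auto intro!: mult_nonneg_nonneg)
  have C_Suc: "cost r (\<theta> (Suc k)) \<le> cost r (\<theta> k)" for k
    unfolding \<theta>_Suc by (rule cost_next_point_le[OF pred0])
  have C0: "cost r (\<theta> k) \<le> cost r \<theta>0" for k
    by (induction k) (use init C_Suc order_trans in auto)

  show ?thesis
  proof (rule liminf_eq_0_if_not_eventually_ge)
    fix \<epsilon> :: real and K :: nat
    assume \<epsilon>: "0 < \<epsilon>" and g: "\<And>k. K \<le> k \<Longrightarrow> \<epsilon> \<le> norm (?g k)"
    define \<nu> where "\<nu> = (1 + \<alpha> / 2) * \<zeta>"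
    have \<nu>: "0 < \<nu>" using assms(4) \<zeta>(1) by (simp add: \<nu>_def)

    \<comment> \<open>How small the radius has to be: all the conditions hold near zero by continuity.
      In order: the multiplier is large, the acceleration test is passed, the step stays in the
      neighbourhood of the level set, the minimum in the decrease condition is the radius itself,
      and the quadratic discrepancy is at most three quarters of the predicted reduction.\<close>
    have "\<forall>\<^sub>F t in at_right (0::real). 2 * \<beta> * (\<zeta> * t) < \<epsilon> \<and> 2 * sqrt \<beta> * \<kappa> * (\<zeta> * t)\<^sup>2 < \<alpha> * \<epsilon>
        \<and> \<nu> * t < R0 \<and> t < \<epsilon> / \<beta> \<and> L * \<nu>\<^sup>2 * t < 3/4 * c1 * \<epsilon>"
    proof (intro eventually_conj)
      have *: "\<forall>\<^sub>F t in at_right (0::real). h t < b" if "continuous (at_right 0) h" "h 0 < b"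
        for h :: "real \<Rightarrow> real" and b
        using that by (auto simp: continuous_within dest: order_tendstoD(2))
      show "\<forall>\<^sub>F t in at_right (0::real). 2 * \<beta> * (\<zeta> * t) < \<epsilon>"
        by (rule *) (auto intro!: continuous_intros simp: \<epsilon>)
      show "\<forall>\<^sub>F t in at_right (0::real). 2 * sqrt \<beta> * \<kappa> * (\<zeta> * t)\<^sup>2 < \<alpha> * \<epsilon>"
        by (rule *) (auto intro!: continuous_intros simp: \<epsilon> assms(4))
      show "\<forall>\<^sub>F t in at_right (0::real). \<nu> * t < R0"
        by (rule *) (auto intro!: continuous_intros simp: R0)
      show "\<forall>\<^sub>F t in at_right (0::real). t < \<epsilon> / \<beta>"
        by (rule *) (auto intro!: continuous_intros simp: \<epsilon> \<beta>)
      show "\<forall>\<^sub>F t in at_right (0::real). L * \<nu>\<^sup>2 * t < 3/4 * c1 * \<epsilon>"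
        by (rule *) (auto intro!: continuous_intros simp: \<epsilon> c1)
    qed
    then obtain b where b: "0 < b" and small: "\<And>t. 0 < t \<Longrightarrow> t < b \<Longrightarrow>
        2 * \<beta> * (\<zeta> * t) < \<epsilon> \<and> 2 * sqrt \<beta> * \<kappa> * (\<zeta> * t)\<^sup>2 < \<alpha> * \<epsilon>
        \<and> \<nu> * t < R0 \<and> t < \<epsilon> / \<beta> \<and> L * \<nu>\<^sup>2 * t < 3/4 * c1 * \<epsilon>"
      unfolding eventually_at_right_field by auto

    have pred_ge: "c1 * \<epsilon> * min (\<Delta> k) (\<epsilon> / \<beta>) \<le> ?pred k" if "K \<le> k" for k
      using cauchy_decrease_ge[OF \<beta>(2) \<epsilon> g[OF that], of c1 "\<Delta> k"] c1 \<Delta>[of k] pred[of k] by linarith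

    have not_reduced: "\<Delta> k \<le> \<Delta> (Suc k)" if k: "K \<le> k" and "\<Delta> k \<le> b / 2" for k
    proof -
      have sm: "2 * \<beta> * (\<zeta> * \<Delta> k) < \<epsilon>" "2 * sqrt \<beta> * \<kappa> * (\<zeta> * \<Delta> k)\<^sup>2 < \<alpha> * \<epsilon>"
        "\<nu> * \<Delta> k < R0" "\<Delta> k < \<epsilon> / \<beta>" "L * \<nu>\<^sup>2 * \<Delta> k < 3/4 * c1 * \<epsilon>"
        using small[of "\<Delta> k"] \<Delta>[of k] that(2) b by auto
      have s2: "?s2 k \<le> \<alpha> * ?s1 k / 2"
        by (rule acceleration_small[OF \<beta>(2) inv lam _ \<kappa>(2) \<epsilon> g[OF k] less_imp_le[OF \<zeta>(2)]])
          (use sm \<kappa>(1) assms(4) in auto)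
      have "norm (?d k) \<le> ?s1 k + ?s2 k"
        unfolding full_step_def by (rule norm_triangle_ineq)
      also have "\<dots> \<le> (1 + \<alpha> / 2) * ?s1 k"
        using s2 by (simp add: algebra_simps)
      also have "\<dots> \<le> (1 + \<alpha> / 2) * (\<zeta> * \<Delta> k)"
        using \<zeta>(2)[of k] assms(4) by (intro mult_left_mono) auto
      finally have d: "norm (?d k) \<le> \<nu> * \<Delta> k" by (simp add: \<nu>_def mult_ac)
      have "L * (norm (?d k))\<^sup>2 \<le> L * (\<nu> * \<Delta> k)\<^sup>2"
        using d L0 by (intro mult_left_mono power_mono) auto
      also have "\<dots> = L * \<nu>\<^sup>2 * \<Delta> k * \<Delta> k" by (simp add: power2_eq_square)
      also have "\<dots> \<le> 3/4 * c1 * \<epsilon> * \<Delta> k"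
        using sm(5) \<Delta>[of k] by (intro mult_right_mono) auto
      finally have loss: "L * (norm (?d k))\<^sup>2 \<le> 3/4 * (c1 * \<epsilon> * \<Delta> k)" by (simp add: mult_ac)
      have gain: "c1 * \<epsilon> * \<Delta> k \<le> ?pred k" using pred_ge[OF k] sm(4) by simp
      show ?thesis
        unfolding \<Delta>_Suc
      proof (rule radius_not_reduced[OF s2])
        show "0 < ?pred k" using gain c1 \<epsilon> \<Delta>[of k] by (intro less_le_trans[OF _ gain]) auto
        show "L * (norm (?d k))\<^sup>2 \<le> 3/4 * ?pred k"
          by (rule order_trans[OF loss mult_left_mono[OF gain]]) simp
        show "?pred k - L * (norm (?d k))\<^sup>2 \<le> cost r (\<theta> k) - cost r (\<theta> k + ?d k)"
          using d sm(3) by (intro cost_reduction_ge_model_reduction[OF G L C0 assms(6)]) auto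
      qed (use \<Delta> in auto)
    qed

    define \<delta> where "\<delta> = min (\<Delta> K) (b / 2 / 4)"
    have \<delta>: "0 < \<delta>" using \<Delta>[of K] b by (simp add: \<delta>_def)
    have \<Delta>_ge: "\<delta> \<le> \<Delta> k" if "K \<le> k" for k
      unfolding \<delta>_def by (rule radius_bounded_below[where D = \<Delta>, OF quarter not_reduced that])
    define p where "p = c1 * \<epsilon> * min \<delta> (\<epsilon> / \<beta>)"
    have p: "0 < p" using c1 \<epsilon> \<delta> \<beta>(1) by (simp add: p_def)
    have p_le: "p \<le> ?pred k" if "K \<le> k" for k
    proof -
      have "p \<le> c1 * \<epsilon> * min (\<Delta> k) (\<epsilon> / \<beta>)"
        unfolding p_def using c1 \<epsilon> \<Delta>_ge[OF that] by (intro mult_left_mono) auto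
      then show ?thesis using pred_ge[OF that] by linarith
    qed
    show False
    proof (rule no_persistent_shrink_or_decrease[of "\<lambda>k. cost r (\<theta> k)" \<delta> K \<Delta> "p / 4"])
      show "0 \<le> cost r (\<theta> k)" for k by (simp add: cost_eq_norm)
      show "\<Delta> (Suc k) = \<Delta> k / 4 \<or> cost r (\<theta> (Suc k)) \<le> cost r (\<theta> k) - p / 4" if "K \<le> k" for k
        unfolding \<Delta>_Suc \<theta>_Suc by (rule radius_quartered_or_cost_decreased[OF pred0 p_le[OF that]])
    qed (use C_Suc \<delta> \<Delta>_ge p in auto)
  qed simp
qed

end
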